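(* Let $n\ge p$ be positive integers, let $\mathbb{E}$ be a finite-dimensional Euclidean space, let $\mathcal{A}:\mathbb{R}^{n\times p}\to\mathbb{E}$ be linear, $b\in\mathbb{E}$, and define the closed, proper, convex function $f:\mathbb{R}^{n\times p}\to\mathbb{R}\cup\{+\infty\}$ by $f(X)=\|X\|_*+\delta_{\{0\}}(\mathcal{A}(X)-b)$. For $\bar X\in\mathbb{R}^{n\times p}$ such that $\mathcal{A}(\bar X)=b$, the following are equivalent: (I) $0\in\operatorname{int}\partial f(\bar X)$. (II) Both of the following conditions hold: (i) $\operatorname{ri}(\partial\|\cdot\|_*(\bar X))\cap\operatorname{rge}\mathcal{A}^*\neq\emptyset$; (ii) $\operatorname{par}(\partial\|\cdot\|_*(\bar X))+\operatorname{rge}\mathcal{A}^*=\mathbb{R}^{n\times p}$.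
   Context: $\mathbb{R}^{n\times p}$ carries the inner product $\langle X,Y\rangle=\operatorname{tr}(X^TY)$; $\mathcal{A}^*$ is the adjoint of $\mathcal{A}$ and $\operatorname{rge}\mathcal{A}^*$ its range. $\|\cdot\|_*$ is the nuclear norm (sum of singular values). $\delta_{\{0\}}(y)=0$ if $y=0$ and $+\infty$ otherwise. For a convex function $g$ and $\bar X\in\operatorname{dom}g=\{X:g(X)<+\infty\}$, $\partial g(\bar X)=\{Y: g(\bar X)+\langle Y,X-\bar X\rangle\le g(X)\ \forall X\in\operatorname{dom}g\}$ is the convex subdifferential. For a nonempty convex set $C$, $\operatorname{ri}C$ is its relative interior (interior relative to the affine hull $\operatorname{aff}C$) and $\operatorname{par}C=\operatorname{aff}C-x$ (any $x\in C$) is the subspace parallel to $C$. *)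

theory Defs
  imports "HOL-Analysis.Analysis"
begin

text \<open>
  An \<open>n \<times> p\<close> matrix is an element of \<open>real^'p^'n\<close>; the inner product of that type is the
  trace inner product.
\<close>

lemma inner_eq_trace:
  fixes X Y :: "real^'p^'n"
  shows "X \<bullet> Y = trace (transpose X ** Y)"
  unfolding trace_def transpose_def matrix_matrix_mult_def inner_vec_def
  by (simp, rule sum.swap)

text \<open>
  The singular values are the nonnegative square roots of the eigenvalues of \<open>X\<^sup>T X\<close>. As \<open>X\<^sup>T X\<close>
  is symmetric, the multiplicity of an eigenvalue is the dimension of its eigenspace. This lists
  \<open>p\<close> singular values counted with multiplicity, which is the usual number when \<open>p \<le> n\<close>
  (when \<open>p > n\<close> it only adds zeros).
\<close>

definition singular_values :: "real^'p^'n \<Rightarrow> real set" where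
  "singular_values X =
     {\<sigma>. 0 \<le> \<sigma> \<and> (\<exists>v. v \<noteq> 0 \<and> (transpose X ** X) *v v = \<sigma>\<^sup>2 *\<^sub>R v)}"

definition sv_multiplicity :: "real^'p^'n \<Rightarrow> real \<Rightarrow> nat" where
  "sv_multiplicity X \<sigma> = dim {v. (transpose X ** X) *v v = \<sigma>\<^sup>2 *\<^sub>R v}"

definition nuclear_norm :: "real^'p^'n \<Rightarrow> real" where
  "nuclear_norm X = (\<Sum>\<sigma>\<in>singular_values X. real (sv_multiplicity X \<sigma>) * \<sigma>)"

lemma finite_singular_values: "finite (singular_values (X :: real^'p^'n))"
proof -
  define M where "M = transpose X ** X"
  have symm: "(M *v u) \<bullet> w = u \<bullet> (M *v w)" for u w
    by (metis M_def dot_lmul_matrix matrix_transpose_mul transpose_transpose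
        vector_transpose_matrix)
  have "\<forall>\<sigma>\<in>singular_values X. \<exists>v. v \<noteq> 0 \<and> M *v v = \<sigma>\<^sup>2 *\<^sub>R v"
    by (auto simp: singular_values_def M_def)
  then obtain v where v: "\<And>\<sigma>. \<sigma> \<in> singular_values X \<Longrightarrow> v \<sigma> \<noteq> 0 \<and> M *v v \<sigma> = \<sigma>\<^sup>2 *\<^sub>R v \<sigma>"
    by metis
  have orth: "v s \<bullet> v t = 0"
    if "s \<in> singular_values X" "t \<in> singular_values X" "s \<noteq> t" for s t
  proof -
    have "s\<^sup>2 * (v s \<bullet> v t) = t\<^sup>2 * (v s \<bullet> v t)"
      using symm[of "v s" "v t"] v that by simp
    moreover have "s\<^sup>2 \<noteq> t\<^sup>2"
      using that by (auto simp: singular_values_def)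
    ultimately show ?thesis by simp
  qed
  have inj: "inj_on v (singular_values X)"
    by (rule inj_onI) (metis orth v inner_eq_zero_iff)
  have "pairwise orthogonal (v ` singular_values X)"
    using orth by (auto simp: pairwise_def orthogonal_def)
  then have "independent (v ` singular_values X)"
    using v by (intro pairwise_orthogonal_independent) auto
  then have "finite (v ` singular_values X)"
    using independent_bound by blast
  then show ?thesis
    using inj finite_imageD by blast
qed

definition delta_zero :: "'e::real_vector \<Rightarrow> ereal" where
  "delta_zero y = (if y = 0 then 0 else \<infinity>)"

definition effective_dom :: "('a \<Rightarrow> ereal) \<Rightarrow> 'a set" where
  "effective_dom g = {x. g x < \<infinity>}"

definition subdifferential :: "('a::real_inner \<Rightarrow> ereal) \<Rightarrow> 'a \<Rightarrow> 'a set" where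
  "subdifferential g x = {y. \<forall>z\<in>effective_dom g. g x + ereal (y \<bullet> (z - x)) \<le> g z}"

definition par :: "'a::real_vector set \<Rightarrow> 'a set" where
  "par C = (\<lambda>y. y - (SOME x. x \<in> C)) ` (affine hull C)"

lemma par_eq:
  assumes "x \<in> C"
  shows "par C = (\<lambda>y. y - x) ` (affine hull C)"
proof -
  have *: "(\<lambda>y. y - a) ` (affine hull C) \<subseteq> (\<lambda>y. y - c) ` (affine hull C)"
    if "a \<in> C" "c \<in> C" for a c
  proof
    fix z assume "z \<in> (\<lambda>y. y - a) ` (affine hull C)"
    then obtain y where y: "y \<in> affine hull C" "z = y - a" by blast
    have "y + 1 *\<^sub>R (c - a) \<in> affine hull C"
      by (intro mem_affine_3_minus affine_affine_hull y hull_inc that)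
    then show "z \<in> (\<lambda>y. y - c) ` (affine hull C)"
      using y(2) by (intro image_eqI[where x = "y + 1 *\<^sub>R (c - a)"]) auto
  qed
  show ?thesis
    unfolding par_def using * assms someI[of "\<lambda>x. x \<in> C"] by (meson subset_antisym)
qed

end

theory Submission
  imports Defs
begin

text \<open>
  The nuclear norm is the support function of the operator norm unit ball, hence convex and finite.
  Therefore the subdifferential of \<open>f\<close> at \<open>Xbar\<close> is \<open>C + R\<close>, where \<open>C\<close> is the subdifferential of
  the nuclear norm and \<open>R = (ker A)\<^sup>\<bottom> = rge A*\<close>: a subgradient of the restriction to
  \<open>Xbar + ker A\<close> extends by separating its graph from the strict epigraph. Since
  \<open>ri (C + R) = ri C + R\<close> and \<open>aff (C + R) = aff C + R\<close>, condition (i) says that \<open>0\<close> lies in the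
  relative interior of \<open>C + R\<close>, and (ii) that \<open>C + R\<close> has full dimension.
\<close>

section \<open>Spectral decomposition of the Gram matrix\<close>

text \<open>The engine of the spectral theorem: applied to the orthogonal complement of the
  eigenvectors found so far, it produces one more, which shows that complement to be
  trivial.\<close>

lemma selfadjoint_eigenvector:
  fixes g :: "'a::euclidean_space \<Rightarrow> 'a"
  assumes lin: "linear g" and self: "\<And>x y. g x \<bullet> y = x \<bullet> g y"
    and S: "subspace S" "g ` S \<subseteq> S" "S \<noteq> {0}"
  obtains v where "v \<in> S" "norm v = 1" "g v = (v \<bullet> g v) *\<^sub>R v"
proof -
  let ?K = "S \<inter> sphere 0 1"
  have "0 \<in> S" using S(1) by (rule subspace_0)
  then obtain u where u: "u \<in> S" "u \<noteq> 0" using S(3) by blast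
  have ne: "?K \<noteq> {}"
    using u subspace_scale[OF S(1) u(1), of "inverse (norm u)"] 
    by (auto intro!: exI[of _ "inverse (norm u) *\<^sub>R u"])
  have comp: "compact ?K"
    by (intro closed_Int_compact closed_subspace S(1)) auto
  have "continuous_on ?K (\<lambda>x. x \<bullet> g x)"
    by (intro continuous_intros linear_continuous_on_compose[OF continuous_on_id lin, simplified])
  \<comment> \<open>a maximiser of the Rayleigh quotient on \<open>S\<close> is an eigenvector\<close>
  from continuous_attains_sup[OF comp ne this]
  obtain v where v: "v \<in> S" "norm v = 1" and vmax: "\<And>y. y \<in> S \<Longrightarrow> norm y = 1 \<Longrightarrow> y \<bullet> g y \<le> v \<bullet> g v"
    by auto
  define l where "l = v \<bullet> g v"
  have bound: "y \<bullet> g y \<le> l * (y \<bullet> y)" if "y \<in> S" for y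
  proof (cases "y = 0")
    case False
    have "(inverse (norm y) *\<^sub>R y) \<bullet> g (inverse (norm y) *\<^sub>R y) \<le> l"
      unfolding l_def using False that by (intro vmax subspace_scale S(1)) auto
    then have "(y \<bullet> g y) / (norm y)\<^sup>2 \<le> l"
      by (simp add: linear_scale[OF lin] power2_eq_square field_simps)
    then show ?thesis
      using False by (simp add: dot_square_norm field_simps)
  qed (simp add: linear_0[OF lin])
  \<comment> \<open>The residual \<open>w\<close> of the eigenvector equation is itself a direction
    inside \<open>S\<close>, so the maximality of \<open>v\<close> can be tested along
    \<open>v + t *\<^sub>R w\<close>.\<close>
  define w where "w = g v - l *\<^sub>R v"
  have wS: "w \<in> S"
    unfolding w_def using S v by (intro subspace_diff subspace_scale) auto
  define e where "e = w \<bullet> g w - l * (w \<bullet> w)"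
  have quad: "2 * t * (w \<bullet> w) + t\<^sup>2 * e \<le> 0" for t
  proof -
    have "v + t *\<^sub>R w \<in> S"
      using S v wS by (intro subspace_add subspace_scale)
    from bound[OF this]
    have "l + t * (v \<bullet> g w) + t * (w \<bullet> g v) + t\<^sup>2 * (w \<bullet> g w) 
      \<le> l * (1 + 2 * t * (v \<bullet> w) + t\<^sup>2 * (w \<bullet> w))"
      using v(2) by (simp add: linear_add[OF lin] linear_scale[OF lin] inner_simps l_def
          power2_eq_square algebra_simps inner_commute[of w v] norm_eq_1)
    moreover have "v \<bullet> g w = w \<bullet> g v"
      using self[of v w] by (simp add: inner_commute)
    moreover have "w \<bullet> g v = w \<bullet> w + l * (v \<bullet> w)"
      by (subst (2) w_def) (simp add: inner_diff_right inner_commute)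
    ultimately show ?thesis
      by (simp add: e_def algebra_simps power2_eq_square)
  qed
  have "w = 0"
  proof (rule ccontr)
    assume "w \<noteq> 0"
    then have d: "w \<bullet> w > 0" by simp
    \<comment> \<open>Small enough for the linear term of \<open>quad\<close> to dominate:
      \<open>t * \<bar>e\<bar>\<close> stays below \<open>w \<bullet> w\<close>. The summand 1 keeps
      the denominator positive.\<close>
    define t where "t = (w \<bullet> w) / (\<bar>e\<bar> + 1)"
    have t: "t > 0" "t * (\<bar>e\<bar> + 1) = w \<bullet> w"
      using d by (auto simp: t_def)
    have "t * (2 * (w \<bullet> w) + t * e) \<le> 0"
      using quad[of t] by (simp add: algebra_simps power2_eq_square)
    then have "2 * (w \<bullet> w) + t * e \<le> 0"
      using t(1) by (simp add: mult_le_0_iff)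
    moreover have "t * (- \<bar>e\<bar>) \<le> t * e"
      using t(1) by (intro mult_left_mono) auto
    ultimately show False
      using t d by (simp add: algebra_simps)
  qed
  then show thesis
    using v by (intro that[of v]) (auto simp: w_def l_def)
qed

lemma gram_inner:
  fixes X :: "real^'p^'n"
  shows "x \<bullet> ((transpose X ** X) *v y) = (X *v x) \<bullet> (X *v y)"
  by (metis dot_lmul_matrix matrix_vector_mul_assoc vector_transpose_matrix transpose_transpose)

text \<open>Collect an orthonormal basis of each eigenspace of \<open>transpose X ** X\<close>.
  These are right singular vectors: \<open>X\<close> keeps them orthogonal and stretches each by its
  singular value, and each value occurs as often as its multiplicity says.\<close>

lemma nuclear_norm_eigenbasis:
  fixes X :: "real^'p^'n"
  obtains B where "finite B" "pairwise orthogonal B" "\<And>v. v \<in> B \<Longrightarrow> norm v = 1" "span B = UNIV"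
    "pairwise (\<lambda>v w. orthogonal (X *v v) (X *v w)) B"
    "nuclear_norm X = (\<Sum>v\<in>B. norm (X *v v))"
proof -
  define M where "M = transpose X ** X"
  define E where "E s = {v. M *v v = s\<^sup>2 *\<^sub>R v}" for s
  let ?SV = "singular_values X"
  have subE: "subspace (E s)" for s
    by (auto simp: E_def subspace_def matrix_vector_right_distrib scaleR_right_distrib
        matrix_vector_mult_scaleR)
  have self: "(M *v u) \<bullet> w = u \<bullet> (M *v w)" for u w
    using gram_inner[of w X u] gram_inner[of u X w] by (simp add: M_def inner_commute)
  have "\<exists>B. B \<subseteq> E s \<and> pairwise orthogonal B \<and> (\<forall>x\<in>B. norm x = 1) \<and> independent B
      \<and> card B = dim (E s) \<and> span B = E s" for s
    using orthonormal_basis_subspace[OF subE[of s]] by metis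
  then obtain C where C: "\<And>s. C s \<subseteq> E s" "\<And>s. pairwise orthogonal (C s)"
     "\<And>s x. x \<in> C s \<Longrightarrow> norm x = 1" "\<And>s. independent (C s)"
     "\<And>s. card (C s) = dim (E s)" "\<And>s. span (C s) = E s"
    by metis
  have finC: "finite (C s)" for s
    using C(4) independent_imp_finite by blast
  define B where "B = (\<Union>s\<in>?SV. C s)"
  have finB: "finite B"
    using finite_singular_values finC by (auto simp: B_def)
  have normB: "norm v = 1" if "v \<in> B" for v
    using that C(3) by (auto simp: B_def)
  have orthE: "v \<bullet> w = 0" if "v \<in> E s" "w \<in> E t" "s \<in> ?SV" "t \<in> ?SV" "s \<noteq> t" for v w s t
  proof -
    have "s\<^sup>2 * (v \<bullet> w) = t\<^sup>2 * (v \<bullet> w)"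
      using self[of v w] that by (simp add: E_def)
    moreover have "s\<^sup>2 \<noteq> t\<^sup>2"
      using that by (auto simp: singular_values_def)
    ultimately show ?thesis by simp
  qed
  have orthB: "pairwise orthogonal B"
  proof (rule pairwiseI)
    fix v w assume "v \<in> B" "w \<in> B" "v \<noteq> w"
    then obtain s t where st: "s \<in> ?SV" "t \<in> ?SV" "v \<in> C s" "w \<in> C t"
      by (auto simp: B_def)
    show "orthogonal v w"
      using C(2)[of s] orthE[of v s w t] st C(1) \<open>v \<noteq> w\<close>
      by (cases "s = t") (auto simp: pairwise_def orthogonal_def)
  qed
  have disj: "C s \<inter> C t = {}" if "s \<in> ?SV" "t \<in> ?SV" "s \<noteq> t" for s t
  proof -
    have False if "v \<in> C s" "v \<in> C t" for v
      using orthE[of v s v t] C(1,3) that \<open>s \<in> ?SV\<close> \<open>t \<in> ?SV\<close> \<open>s \<noteq> t\<close>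
      by (metis inner_eq_zero_iff norm_zero subsetD zero_neq_one)
    then show ?thesis by blast
  qed
  have eig: "\<exists>s\<in>?SV. M *v v = s\<^sup>2 *\<^sub>R v" if "v \<in> B" for v
    using that C(1) by (auto simp: B_def E_def)
  \<comment> \<open>Otherwise the orthogonal complement of \<open>B\<close> is a nonzero invariant
    subspace, and an eigenvector in it would already lie in the span of some
    \<open>C s\<close>.\<close>
  have spanB: "span B = UNIV"
  proof (rule ccontr)
    assume "span B \<noteq> UNIV"
    define S where "S = orthogonal_comp (span B)"
    have S: "x \<in> S \<longleftrightarrow> (\<forall>v\<in>B. v \<bullet> x = 0)" for x
      unfolding S_def orthogonal_comp_def
      by (auto simp: orthogonal_def span_base)
         (metis orthogonal_def orthogonal_to_span inner_commute)
    have "span B \<subset> span UNIV"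
      using \<open>span B \<noteq> UNIV\<close> by auto
    then obtain x where x: "x \<noteq> 0" "\<And>y. y \<in> span B \<Longrightarrow> orthogonal x y"
      by (rule orthogonal_to_subspace_exists_gen) metis
    then have "x \<in> S"
      by (simp add: S orthogonal_def span_base inner_commute)
    then have "S \<noteq> {0}" using x(1) by blast
    moreover have "(*v) M ` S \<subseteq> S"
    proof (clarsimp simp: S)
      fix x v assume x: "\<forall>v\<in>B. v \<bullet> x = 0" and v: "v \<in> B"
      obtain s where "M *v v = s\<^sup>2 *\<^sub>R v" using eig[OF v] by blast
      then show "v \<bullet> (M *v x) = 0"
        using self[of v x] x v by simp
    qed
    ultimately obtain v where v: "v \<in> S" "norm v = 1" "M *v v = (v \<bullet> (M *v v)) *\<^sub>R v"
      using selfadjoint_eigenvector[of "(*v) M" S] self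
      by (auto simp: S_def subspace_orthogonal_comp)
    \<comment> \<open>The eigenvalue \<open>v \<bullet> (M *v v)\<close> equals the square of
      \<open>norm (X *v v)\<close>, so it is nonnegative and its root qualifies as a singular
      value.\<close>
    define s where "s = norm (X *v v)"
    have vE: "M *v v = s\<^sup>2 *\<^sub>R v"
      using v(3) by (metis M_def gram_inner power2_norm_eq_inner s_def)
    moreover have "v \<noteq> 0" using v(2) by auto
    ultimately have "s \<in> ?SV"
      by (auto simp: singular_values_def M_def s_def)
    have "v \<in> span (C s)" using vE C(6) by (simp add: E_def)
    then have "v \<in> span B"
      using span_mono[of "C s" B] \<open>s \<in> ?SV\<close> by (auto simp: B_def)
    then have "v \<bullet> v = 0"
      using v(1) by (auto simp: S_def orthogonal_comp_def orthogonal_def)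
    then show False using v(2) by simp
  qed
  have orthX: "pairwise (\<lambda>v w. orthogonal (X *v v) (X *v w)) B"
  proof (rule pairwiseI)
    fix v w assume vw: "v \<in> B" "w \<in> B" "v \<noteq> w"
    obtain s where "M *v w = s\<^sup>2 *\<^sub>R w" using eig vw by blast
    then show "orthogonal (X *v v) (X *v w)"
      using orthB vw gram_inner[of v X w] by (auto simp: orthogonal_def pairwise_def M_def)
  qed
  have nX: "norm (X *v v) = s" if "v \<in> C s" "s \<in> ?SV" for v s
  proof -
    have "(norm (X *v v))\<^sup>2 = s\<^sup>2"
      using gram_inner[of v X v] C(1)[of s] C(3)[OF that(1)] that
      by (auto simp: E_def M_def power2_norm_eq_inner norm_eq_1)
    then show ?thesis using that(2) by (simp add: singular_values_def)
  qed
  have "(\<Sum>v\<in>B. norm (X *v v)) = (\<Sum>s\<in>?SV. \<Sum>v\<in>C s. norm (X *v v))"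
    unfolding B_def using finite_singular_values finC disj by (intro sum.UNION_disjoint) auto
  also have "\<dots> = (\<Sum>s\<in>?SV. \<Sum>v\<in>C s. s)"
    by (intro sum.cong refl nX)
  also have "\<dots> = nuclear_norm X"
    unfolding nuclear_norm_def sv_multiplicity_def using C(5) by (simp add: E_def M_def)
  finally show thesis
    using that finB orthB normB spanB orthX by metis
qed

section \<open>Duality between the nuclear norm and the operator norm\<close>

text \<open>The trace does not depend on the orthonormal basis: apply Parseval to each pair of rows
  and exchange the sums.\<close>

lemma inner_matrix_orthonormal_basis:
  fixes X W :: "real^'p^'n"
  assumes "finite B" "pairwise orthogonal B" "\<And>v. v \<in> B \<Longrightarrow> norm v = 1" "span B = UNIV"
  shows "X \<bullet> W = (\<Sum>v\<in>B. (X *v v) \<bullet> (W *v v))"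
proof -
  have parseval: "x \<bullet> y = (\<Sum>v\<in>B. (x \<bullet> v) * (y \<bullet> v))" for x y :: "real^'p"
  proof -
    have y: "(\<Sum>v\<in>B. (y \<bullet> v) *\<^sub>R v) = y"
      by (rule orthonormal_basis_expand) (simp_all add: assms)
    have "x \<bullet> (\<Sum>v\<in>B. (y \<bullet> v) *\<^sub>R v) = (\<Sum>v\<in>B. (x \<bullet> v) * (y \<bullet> v))"
      by (simp add: inner_sum_right mult.commute)
    then show ?thesis unfolding y .
  qed
  have "X \<bullet> W = (\<Sum>i\<in>UNIV. \<Sum>v\<in>B. (X $ i \<bullet> v) * (W $ i \<bullet> v))"
    unfolding inner_vec_def[of X] by (rule sum.cong[OF refl parseval])
  also have "\<dots> = (\<Sum>v\<in>B. \<Sum>i\<in>UNIV. (X $ i \<bullet> v) * (W $ i \<bullet> v))"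
    by (rule sum.swap)
  also have "\<dots> = (\<Sum>v\<in>B. (X *v v) \<bullet> (W *v v))"
    by (simp add: inner_vec_def[where ?'b = 'n] matrix_vector_mul_component)
  finally show ?thesis .
qed

text \<open>Expand the trace in right singular vectors of \<open>X\<close> and use Cauchy-Schwarz in
  each term. This is the upper bound half of the duality.\<close>

lemma inner_le_nuclear_norm:
  fixes X W :: "real^'p^'n"
  assumes "\<And>x. norm (W *v x) \<le> norm x"
  shows "X \<bullet> W \<le> nuclear_norm X"
proof -
  obtain B where B: "finite B" "pairwise orthogonal B" "\<And>v. v \<in> B \<Longrightarrow> norm v = 1" "span B = UNIV"
    and N: "nuclear_norm X = (\<Sum>v\<in>B. norm (X *v v))"
    using nuclear_norm_eigenbasis[of X] by metis
  have "(X *v v) \<bullet> (W *v v) \<le> norm (X *v v)" if "v \<in> B" for v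
  proof -
    have "(X *v v) \<bullet> (W *v v) \<le> norm (X *v v) * norm (W *v v)"
      by (rule norm_cauchy_schwarz)
    also have "\<dots> \<le> norm (X *v v) * 1"
      using assms[of v] B(3)[OF that] by (intro mult_left_mono) auto
    finally show ?thesis by simp
  qed
  then show ?thesis
    unfolding N by (subst inner_matrix_orthonormal_basis[where B = B]) (auto intro: sum_mono simp: B)
qed

text \<open>Aligning \<open>W *v v\<close> with \<open>X *v v\<close> for each right singular vector
  \<open>v\<close> makes every Cauchy-Schwarz estimate in the upper bound an equality.\<close>

lemma nuclear_norm_attained:
  fixes X :: "real^'p^'n"
  obtains W :: "real^'p^'n" where "\<And>x. norm (W *v x) \<le> norm x" "X \<bullet> W = nuclear_norm X"
proof -
  obtain B where B: "finite B" "pairwise orthogonal B" "\<And>v. v \<in> B \<Longrightarrow> norm v = 1" "span B = UNIV"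
    and orthX: "pairwise (\<lambda>v w. orthogonal (X *v v) (X *v w)) B"
    and N: "nuclear_norm X = (\<Sum>v\<in>B. norm (X *v v))"
    using nuclear_norm_eigenbasis[of X] by metis
  \<comment> \<open>the partial isometry of the polar decomposition; \<open>sgn 0 = 0\<close> takes care of \<open>ker X\<close>\<close>
  define h where "h x = (\<Sum>v\<in>B. (x \<bullet> v) *\<^sub>R sgn (X *v v))" for x
  have "linear h"
    unfolding h_def by (intro linearI) (auto simp: inner_simps scaleR_add_left sum.distrib scaleR_sum_right)
  then have W: "matrix h *v x = h x" for x
    by (simp add: matrix_works)
  \<comment> \<open>The images of the basis vectors are orthogonal and have length 0 or 1, so
    Pythagoras on both sides compares the norms term by term.\<close>
  have contr: "norm (h x) \<le> norm x" for x
  proof -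
    have x: "(\<Sum>v\<in>B. (x \<bullet> v) *\<^sub>R v) = x"
      using orthonormal_basis_expand[of B x] B by simp
    have "(norm (h x))\<^sup>2 = (\<Sum>v\<in>B. (norm ((x \<bullet> v) *\<^sub>R sgn (X *v v)))\<^sup>2)"
      unfolding h_def using orthX B(1)
      by (intro norm_sum_Pythagorean) (auto simp: pairwise_def orthogonal_def sgn_div_norm)
    also have "\<dots> \<le> (\<Sum>v\<in>B. (norm ((x \<bullet> v) *\<^sub>R v))\<^sup>2)"
      by (intro sum_mono power_mono) (auto simp: norm_sgn B(3))
    also have "\<dots> = (norm (\<Sum>v\<in>B. (x \<bullet> v) *\<^sub>R v))\<^sup>2"
      using B(1,2) by (intro norm_sum_Pythagorean[symmetric]) (auto simp: pairwise_def orthogonal_def)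
    finally show ?thesis
      unfolding x by (simp add: power2_le_iff_abs_le)
  qed
  have hB: "h v = sgn (X *v v)" if "v \<in> B" for v
  proof -
    have "h v = (\<Sum>w\<in>B. if w = v then sgn (X *v v) else 0)"
      unfolding h_def
    proof (rule sum.cong)
      fix w assume "w \<in> B"
      then show "(v \<bullet> w) *\<^sub>R sgn (X *v w) = (if w = v then sgn (X *v v) else 0)"
        using B(2,3) that by (auto simp: pairwise_def orthogonal_def norm_eq_1)
    qed simp
    then show ?thesis using that B(1) by simp
  qed
  have "x \<bullet> sgn x = norm x" for x :: "real^'n"
    by (cases "x = 0") (simp_all add: sgn_div_norm dot_square_norm power2_eq_square)
  then have "X \<bullet> matrix h = nuclear_norm X"
    unfolding N by (subst inner_matrix_orthonormal_basis[where B = B]) (auto simp: B W hB)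
  then show thesis
    using contr by (intro that[of "matrix h"]) (auto simp: W)
qed

text \<open>A maximum of linear functions is convex: the \<open>W\<close> optimal at the convex
  combination gives lower bounds at both endpoints.\<close>

lemma convex_on_nuclear_norm: "convex_on UNIV (nuclear_norm :: real^'p^'n \<Rightarrow> real)"
proof (rule convex_onI)
  fix t :: real and X Y :: "real^'p^'n"
  assume t: "0 < t" "t < 1"
  obtain W :: "real^'p^'n" where W: "\<And>x. norm (W *v x) \<le> norm x"
    "((1 - t) *\<^sub>R X + t *\<^sub>R Y) \<bullet> W = nuclear_norm ((1 - t) *\<^sub>R X + t *\<^sub>R Y)"
    using nuclear_norm_attained by blast
  have "(1 - t) * (X \<bullet> W) + t * (Y \<bullet> W) \<le> (1 - t) * nuclear_norm X + t * nuclear_norm Y"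
    using t by (intro add_mono mult_left_mono inner_le_nuclear_norm W(1)) auto
  then show "nuclear_norm ((1 - t) *\<^sub>R X + t *\<^sub>R Y) \<le> (1 - t) * nuclear_norm X + t * nuclear_norm Y"
    unfolding W(2)[symmetric] by (simp add: inner_simps)
qed simp

section \<open>Subdifferentials and the sum rule\<close>

lemma convex_subdifferential: "convex (subdifferential (\<lambda>x. ereal (g x)) x0)"
proof -
  have "subdifferential (\<lambda>x. ereal (g x)) x0 = (\<Inter>z. {y. (z - x0) \<bullet> y \<le> g z - g x0})"
    by (auto simp: subdifferential_def effective_dom_def inner_commute le_diff_eq add.commute)
  then show ?thesis
    by (simp add: convex_INT convex_halfspace_le)
qed

text \<open>A Hahn-Banach extension. The separating hyperplane cannot be vertical because
  \<open>g\<close> is finite everywhere, so it has a slope \<open>z\<close>; this is a subgradient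
  on the whole space and agrees with \<open>y\<close> on \<open>K\<close>.\<close>

lemma subgradient_on_subspace_extends:
  fixes g :: "'a::euclidean_space \<Rightarrow> real"
  assumes cvx: "convex_on UNIV g" and K: "subspace K"
    and le: "\<And>h. h \<in> K \<Longrightarrow> g x0 + y \<bullet> h \<le> g (x0 + h)"
  obtains z where "\<And>h. g x0 + z \<bullet> h \<le> g (x0 + h)" "y - z \<in> orthogonal_comp K"
proof -
  define S where "S = (\<lambda>h. (h, g x0 + y \<bullet> h)) ` K"
  \<comment> \<open>The inequality is strict because the graph \<open>S\<close> touches the epigraph
    at \<open>h = 0\<close>; the strict epigraph is disjoint from it.\<close>
  define T where "T = {(h, t). g (x0 + h) < t}"
  have cvxK: "convex K" using K by (rule subspace_imp_convex)
  have "linear (\<lambda>h. (h, y \<bullet> h))"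
    by (intro linearI) (auto simp: inner_add_right)
  then have "convex ((+) (0, g x0) ` (\<lambda>h. (h, y \<bullet> h)) ` K)"
    using cvxK by (intro convex_translation convex_linear_image)
  then have "convex S"
    by (simp add: S_def image_image)
  moreover have "convex T"
  proof (rule convexI; clarsimp simp: T_def)
    fix h k s t and u v :: real
    assume *: "g (x0 + h) < s" "g (x0 + k) < t" "0 \<le> u" "0 \<le> v" "u + v = 1"
    have eq: "x0 + (u *\<^sub>R h + v *\<^sub>R k) = u *\<^sub>R (x0 + h) + v *\<^sub>R (x0 + k)"
      using *(5) by (simp add: scaleR_right_distrib) (metis scaleR_add_left scaleR_one)
    have "g (x0 + (u *\<^sub>R h + v *\<^sub>R k)) \<le> u * g (x0 + h) + v * g (x0 + k)"
      unfolding eq using cvx * by (auto simp: convex_on_def)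
    also have "\<dots> < u * s + v * t"
    proof (cases "u = 0")
      case False
      then show ?thesis using * by (intro add_less_le_mono mult_strict_left_mono mult_left_mono) auto
    qed (use * in auto)
    finally show "g (x0 + (u *\<^sub>R h + v *\<^sub>R k)) < u * s + v * t" .
  qed
  moreover have "S \<noteq> {}" using subspace_0[OF K] by (auto simp: S_def)
  moreover have "T \<noteq> {}" by (auto simp: T_def intro: lt_ex gt_ex)
  moreover have "S \<inter> T = {}" using le by (force simp: S_def T_def)
  ultimately obtain p c where p: "p \<noteq> 0" "\<And>x. x \<in> S \<Longrightarrow> p \<bullet> x \<le> c" "\<And>x. x \<in> T \<Longrightarrow> c \<le> p \<bullet> x"
    using separating_hyperplane_sets[of S T] by blast
  obtain a \<beta> where ab: "p = (a, \<beta>)" by force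
  have pS: "a \<bullet> h + \<beta> * (g x0 + y \<bullet> h) \<le> c" if "h \<in> K" for h
    using p(2) that by (auto simp: S_def ab)
  have pT: "c \<le> a \<bullet> h + \<beta> * t" if "g (x0 + h) < t" for h t
    using p(3)[of "(h, t)"] that by (auto simp: T_def ab)
  have c0: "\<beta> * g x0 \<le> c" using pS[of 0] subspace_0[OF K] by simp
  have "0 \<le> \<beta>"
    using pT[of 0 "g x0 + 1"] c0 by (simp add: algebra_simps)
  \<comment> \<open>For a vertical hyperplane the bound \<open>pT\<close> would hold for every
    \<open>h\<close>; testing \<open>h = - a\<close> forces \<open>a = 0\<close>.\<close>
  moreover have "\<beta> \<noteq> 0"
  proof
    assume "\<beta> = 0"
    then have "0 \<le> a \<bullet> (- a)"
      using pT[of "- a" "g (x0 - a) + 1"] c0 by simp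
    then have "a = 0"
      using inner_gt_zero_iff[of a] unfolding inner_minus_right by linarith
    then show False using p(1) \<open>\<beta> = 0\<close> ab by (simp add: zero_prod_def)
  qed
  ultimately have \<beta>: "\<beta> > 0" by simp
  \<comment> \<open>Let the height \<open>t\<close> decrease to \<open>g (x0 + h)\<close>.\<close>
  have pT': "c \<le> a \<bullet> h + \<beta> * g (x0 + h)" for h
  proof (rule field_le_epsilon)
    fix e :: real assume "e > 0"
    then show "c \<le> a \<bullet> h + \<beta> * g (x0 + h) + e"
      using pT[of h "g (x0 + h) + e / \<beta>"] \<beta> by (simp add: distrib_left)
  qed
  define z where "z = - (a /\<^sub>R \<beta>)"
  have bound: "(a + \<beta> *\<^sub>R y) \<bullet> h \<le> c - \<beta> * g x0" if "h \<in> K" for h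
    using pS[OF that] by (simp add: inner_simps algebra_simps)
  \<comment> \<open>The hyperplane passes through the contact point at \<open>h = 0\<close>, so
    \<open>c\<close> is \<open>\<beta> * g x0\<close>.\<close>
  have zero: "(a + \<beta> *\<^sub>R y) \<bullet> h \<le> 0" if "h \<in> K" for h
  proof -
    have "c \<le> \<beta> * g x0" using pT'[of 0] by simp
    then show ?thesis using bound[OF that] by simp
  qed
  show thesis
  proof (rule that)
    fix h
    have "\<beta> * g x0 - a \<bullet> h \<le> \<beta> * g (x0 + h)"
      using pT'[of h] c0 by simp
    then show "g x0 + z \<bullet> h \<le> g (x0 + h)"
      using \<beta> by (simp add: z_def field_simps)
  next
    \<comment> \<open>A linear functional that is nonpositive on a subspace vanishes there.\<close>
    have "(a + \<beta> *\<^sub>R y) \<bullet> h = 0" if "h \<in> K" for h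
      using zero[OF that] zero[of "- h"] subspace_neg[OF K that] by simp
    moreover have "y - z = (a + \<beta> *\<^sub>R y) /\<^sub>R \<beta>"
      using \<beta> by (simp add: z_def scaleR_right_distrib)
    ultimately show "y - z \<in> orthogonal_comp K"
      by (auto simp: orthogonal_comp_def orthogonal_def inner_commute)
  qed
qed

text \<open>The indicator leaves only displacements in the kernel of \<open>A\<close> to be tested.
  A functional passing these tests differs from a subgradient of \<open>g\<close> by an element
  orthogonal to the kernel, that is, one in the range of the adjoint.\<close>

lemma subdifferential_add_delta_zero:
  fixes g :: "'a::euclidean_space \<Rightarrow> real" and A :: "'a \<Rightarrow> 'e::euclidean_space"
  assumes cvx: "convex_on UNIV g" and A: "linear A" "A x0 = b"
  shows "subdifferential (\<lambda>x. ereal (g x) + delta_zero (A x - b)) x0 =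
    subdifferential (\<lambda>x. ereal (g x)) x0 + range (adjoint A)"
proof -
  define K where "K = A -` {0}"
  have K: "subspace K" "orthogonal_comp K = range (adjoint A)"
    using A(1) by (auto simp: K_def subspace_orthogonal_comp ker_orthogonal_comp_adjoint
        orthogonal_comp_self linear_subspace_image adjoint_linear)
  have full: "y \<in> subdifferential (\<lambda>x. ereal (g x)) x0 \<longleftrightarrow> (\<forall>h. g x0 + y \<bullet> h \<le> g (x0 + h))" for y
  proof -
    have "(\<forall>h. g x0 + y \<bullet> h \<le> g (x0 + h)) \<longleftrightarrow> (\<forall>x. g x0 + y \<bullet> (x - x0) \<le> g x)"
      by (metis add_diff_cancel_left' add_diff_cancel_right' add.commute diff_add_cancel)
    then show ?thesis
      by (simp add: subdifferential_def effective_dom_def)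
  qed
  have restr: "y \<in> subdifferential (\<lambda>x. ereal (g x) + delta_zero (A x - b)) x0 \<longleftrightarrow>
      (\<forall>h\<in>K. g x0 + y \<bullet> h \<le> g (x0 + h))" (is "?l \<longleftrightarrow> ?r") for y
  proof
    assume l: ?l
    show ?r
    proof
      fix h assume "h \<in> K"
      then have "A (x0 + h) = b" using A by (simp add: K_def linear_add)
      then show "g x0 + y \<bullet> h \<le> g (x0 + h)"
        using l[unfolded subdifferential_def] A(2)
        by (auto simp: effective_dom_def delta_zero_def dest!: spec[of _ "x0 + h"])
    qed
  next
    assume r: ?r
    have "g x0 + y \<bullet> (x - x0) \<le> g x" if "A x = b" for x
      using bspec[OF r, of "x - x0"] that A by (simp add: K_def linear_diff)
    then show ?l
      using A(2) by (auto simp: subdifferential_def effective_dom_def delta_zero_def)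
  qed
  show ?thesis
  proof (intro set_eqI iffI)
    fix y assume "y \<in> subdifferential (\<lambda>x. ereal (g x) + delta_zero (A x - b)) x0"
    then obtain z where z: "\<And>h. g x0 + z \<bullet> h \<le> g (x0 + h)" "y - z \<in> orthogonal_comp K"
      using subgradient_on_subspace_extends[OF cvx K(1)] restr by metis
    have "z + (y - z) \<in> subdifferential (\<lambda>x. ereal (g x)) x0 + range (adjoint A)"
      using z full K(2) by (intro set_plus_intro) auto
    then show "y \<in> subdifferential (\<lambda>x. ereal (g x)) x0 + range (adjoint A)"
      by simp
  next
    fix y assume "y \<in> subdifferential (\<lambda>x. ereal (g x)) x0 + range (adjoint A)"
    then obtain z r where y: "y = z + r" "z \<in> subdifferential (\<lambda>x. ereal (g x)) x0" "r \<in> orthogonal_comp K"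
      unfolding K(2) by (elim set_plus_elim)
    have "r \<bullet> h = 0" if "h \<in> K" for h
      using y(3) that by (auto simp: orthogonal_comp_def orthogonal_def inner_commute)
    then show "y \<in> subdifferential (\<lambda>x. ereal (g x) + delta_zero (A x - b)) x0"
      using y(2) unfolding restr full y(1) by (simp add: inner_add_left)
  qed
qed

section \<open>Affine hull and relative interior of a sum with a subspace\<close>

text \<open>The right side is affine and contains \<open>C + R\<close>; conversely, translation by a
  fixed \<open>r\<close> in \<open>R\<close> commutes with the hull and maps \<open>C\<close> into
  \<open>C + R\<close>.\<close>

lemma affine_hull_plus_subspace:
  fixes C R :: "'a::euclidean_space set"
  assumes R: "subspace R"
  shows "affine hull (C + R) = (affine hull C) + R"
proof
  have "affine ((affine hull C) + R)"
  proof (clarsimp simp: affine_alt)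
    fix x y and u :: real
    assume "x \<in> (affine hull C) + R" "y \<in> (affine hull C) + R"
    then obtain a r b s where *: "x = a + r" "y = b + s" "a \<in> affine hull C" "b \<in> affine hull C" "r \<in> R" "s \<in> R"
      by (metis set_plus_elim)
    have "((1 - u) *\<^sub>R a + u *\<^sub>R b) + ((1 - u) *\<^sub>R r + u *\<^sub>R s) \<in> (affine hull C) + R"
      using * by (intro set_plus_intro mem_affine affine_affine_hull subspace_add subspace_scale R) auto
    then show "(1 - u) *\<^sub>R x + u *\<^sub>R y \<in> (affine hull C) + R"
      by (simp add: * algebra_simps)
  qed
  then show "affine hull (C + R) \<subseteq> (affine hull C) + R"
    by (intro hull_minimal set_plus_mono2 hull_subset) auto
  show "(affine hull C) + R \<subseteq> affine hull (C + R)"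
  proof (clarsimp elim!: set_plus_elim)
    fix a r assume a: "a \<in> affine hull C" and r: "r \<in> R"
    have "(\<lambda>x. r + x) ` (affine hull C) = affine hull ((\<lambda>x. r + x) ` C)"
      by (simp add: affine_hull_translation)
    also have "\<dots> \<subseteq> affine hull (C + R)"
      using r by (intro hull_mono) (auto simp: add.commute[of r])
    finally show "a + r \<in> affine hull (C + R)"
      using a by (auto simp: add.commute)
  qed
qed

text \<open>Being interior means being relatively interior in a set with full affine hull; the two
  conjuncts express these two requirements for \<open>C + R\<close>.\<close>

lemma zero_in_interior_plus_subspace_iff:
  fixes C R :: "'a::euclidean_space set"
  assumes C: "convex C" and R: "subspace R"
  shows "0 \<in> interior (C + R) \<longleftrightarrow> rel_interior C \<inter> R \<noteq> {} \<and> par C + R = UNIV"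
proof (cases "C = {}")
  \<comment> \<open>Both sides fail, since \<open>C + R\<close> and \<open>rel_interior C\<close>
    are empty.\<close>
  case True
  then show ?thesis by simp
next
  case False
  then obtain c where c: "c \<in> C" by blast
  \<comment> \<open>\<open>par C + R\<close> is a translate of the affine hull of
    \<open>C + R\<close>, so one is the whole space exactly when the other is.\<close>
  have par: "par C + R = (\<lambda>y. y - c) ` (affine hull (C + R))"
    unfolding par_eq[OF c] affine_hull_plus_subspace[OF R]
    by (auto simp: set_plus_def image_iff algebra_simps) metis+
  have "surj (\<lambda>y. y - c)" by (rule surjI[of _ "\<lambda>y. y + c"]) simp
  moreover have "inj (\<lambda>y. y - c)" by (simp add: inj_def)
  ultimately have parU: "par C + R = UNIV \<longleftrightarrow> affine hull (C + R) = UNIV"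
    unfolding par by (metis inj_image_eq_iff)
  \<comment> \<open>Relative interiors of convex sets add up, and the affine set \<open>R\<close> is
    its own relative interior.\<close>
  have "rel_interior (C + R) = rel_interior C + R"
    using C R by (simp add: rel_interior_sum subspace_imp_convex rel_interior_affine subspace_imp_affine)
  moreover have "0 \<in> rel_interior C + R \<longleftrightarrow> rel_interior C \<inter> R \<noteq> {}"
  proof
    assume "0 \<in> rel_interior C + R"
    then obtain x r where xr: "0 = x + r" "x \<in> rel_interior C" "r \<in> R"
      by (elim set_plus_elim)
    then have "x \<in> R" using subspace_neg[OF R xr(3)] by (metis eq_neg_iff_add_eq_0)
    then show "rel_interior C \<inter> R \<noteq> {}" using xr by blast
  next
    assume "rel_interior C \<inter> R \<noteq> {}"
    then obtain x where "x \<in> rel_interior C" "x \<in> R" by blast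
    then have "x + (- x) \<in> rel_interior C + R"
      using R by (intro set_plus_intro subspace_neg)
    then show "0 \<in> rel_interior C + R" by simp
  qed
  moreover have "affine hull (C + R) = UNIV" if "0 \<in> interior (C + R)"
    using that by (intro affine_hull_nonempty_interior) auto
  ultimately show ?thesis
    using rel_interior_interior[of "C + R"] unfolding parU by auto
qed

theorem proposition4p4:
  fixes A :: "real^'p^'n \<Rightarrow> 'e::euclidean_space"
    and b :: 'e
    and f :: "real^'p^'n \<Rightarrow> ereal"
    and Xbar :: "real^'p^'n"
  assumes "CARD('p) \<le> CARD('n)"
    and "linear A"
    and "f = (\<lambda>X. ereal (nuclear_norm X) + delta_zero (A X - b))"
    and "A Xbar = b"
  shows "0 \<in> interior (subdifferential f Xbar) \<longleftrightarrow>
    rel_interior (subdifferential (\<lambda>X. ereal (nuclear_norm X)) Xbar) \<inter> range (adjoint A) \<noteq> {} \<and>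
    par (subdifferential (\<lambda>X. ereal (nuclear_norm X)) Xbar) + range (adjoint A) = UNIV"
proof -
  have "subspace (range (adjoint A))"
    using assms(2) by (simp add: linear_subspace_image adjoint_linear)
  from zero_in_interior_plus_subspace_iff[OF convex_subdifferential this, of nuclear_norm Xbar]
  show ?thesis
    unfolding assms(3) subdifferential_add_delta_zero[OF convex_on_nuclear_norm assms(2,4)] .
qed

end
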